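(* Let $n\geq2$ and let $\theta,u,v,r,s$ be constants such that $\theta\neq0$, $u\neq0$ and $r\neq s$. Consider the sets of functions $$E_1=\left\{\frac{\gamma}{(k_4x+k_3)^{n+1}}\,y\right\},$$ $$E_2=\left\{\frac{\gamma(px+q)}{(k_4x+k_3)^{n+2}}\,y\;:\;pk_3-k_4q\neq0,\ p\neq0\right\},$$ $$E_3=\left\{\frac{\gamma}{(px+q)(k_4x+k_3)^{n}}\,y\;:\;pk_3-k_4q\neq0,\ p\neq0\right\},$$ $$E_4=\left\{\frac{\gamma(x+q)}{(x+\sigma)(k_4x+k_3)^{n+1}}\,y\;:\;q\neq \sigma,\ k_4\sigma-k_3\neq0\right\},$$ where in each set $\gamma,k_3,k_4$ (and $p,q,\sigma$ when they occur) range over all constants subject to $\gamma\neq0$, $(k_3,k_4)\neq(0,0)$ and the indicated restrictions. Under the action of the group $G$, the following are, in each case, equivalence classes of the indicated functions: (a) $E_1$, for functions $F=\alpha_1y$ with $\alpha_1(x)=\theta$. (b) $E_2$, for functions $F=\alpha_2y$ with $\alpha_2(x)=ux+v$. (c) $E_3$, for functions $F=\alpha_3y$ with $\alpha_3(x)=1/(ux+v)$. (d) $E_4$, for functions $F=\alpha_4y$ with $\alpha_4(x)=(x+r)/(x+s)$. Moreover, the equivalence classes $E_j$ are pairwise nonequivalent under the action of $G$.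
   Context: For a scalar function $F=F(x,y)$, let $\Omega_F=\frac{d}{dx}+F(x,y)$, acting for $y=y(x)$ by $\Omega_F[u]=\frac{du}{dx}+F(x,y(x))\,u$; $\Omega_F^n[y]$ denotes the $n$-fold iterate applied to $y$. A function $F$ is identified with the equation $\Omega_F^n[y]=0$ that it labels. $G$ is the group of point transformations $x=\rho(z,w)$, $y=\psi(z,w)$ with $$\rho=\frac{k_2z+k_1}{k_4z+k_3}\quad(k_4=0\text{ or }1),\qquad\psi=r_0\,\rho_z^{(n-1)/2}\,w,$$ where the $k_j$ are constants with $\Delta=k_2k_3-k_1k_4\neq0$ and $r_0$ is an arbitrary nonzero constant. It acts on functions of the form $F=\alpha(x)\,y$: the equation $\Omega_F^n[y]=0$ with $F=\alpha(x)y$ is transformed into $\Omega_{Q}^n[w]=0$ with $Q=r_0\,\alpha(\rho(z))\,\rho_z^{(n+1)/2}\,w$. After renaming the variables $(z,w)$ as $(x,y)$, the action reads $$g\cdot\alpha\,(x)=\alpha(\rho(x))\,\frac{\omega}{(k_4x+k_3)^{n+1}},\qquad \omega=r_0\,\Delta^{(n+1)/2},$$ with $\omega$ an arbitrary nonzero constant. Two functions $\alpha(x)y$ and $\beta(x)y$ are equivalent under $G$ if $\beta=g\cdot\alpha$ for some $g\in G$; an equivalence class is an orbit of this action.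
   Formalization: The printed sets are not orbits (x→1/x sends xy to y/x^{n+2}; E3 and E4 overlap). Corrected: p≠0 is dropped in E2 and E3; in E4, x+q and x+σ become px+q and lx+σ, with px+q, lx+σ, k4x+k3 pairwise non-proportional (adding k4q−k3≠0 when p=l=1). *)

theory Defs
  imports Complex_Main
begin

text \<open>
  Constants are taken from an arbitrary field of characteristic 0, which covers real and complex
  constants.  Coefficients \<open>\<alpha>\<close> are rational functions with poles, so two coefficients are
  identified when they agree outside a finite set of points; the values that the totalised
  division assigns at poles are thereby irrelevant.
\<close>

definition same_fun :: "('a \<Rightarrow> 'a) \<Rightarrow> ('a \<Rightarrow> 'a) \<Rightarrow> bool"  (infix "\<simeq>" 50)
  where "\<alpha> \<simeq> \<beta> \<longleftrightarrow> (\<forall>\<^sub>F x in cofinite. \<alpha> x = \<beta> x)"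

text \<open>The function \<open>F(x, y) = \<alpha>(x) y\<close>.\<close>

definition lin :: "('a \<Rightarrow> 'a) \<Rightarrow> 'a \<Rightarrow> 'a \<Rightarrow> 'a::field_char_0"
  where "lin \<alpha> = (\<lambda>x y. \<alpha> x * y)"

text \<open>
  A transformation \<open>x = (k\<^sub>2 z + k\<^sub>1) / (k\<^sub>4 z + k\<^sub>3)\<close>, \<open>y = r\<^sub>0 \<rho>\<^sub>z\<^bsup>(n-1)/2\<^esup> w\<close> is recorded as
  \<open>(k\<^sub>1, k\<^sub>2, k\<^sub>3, k\<^sub>4, \<omega>)\<close>.  For given \<open>k\<^sub>j\<close>, the relation \<open>\<omega> = r\<^sub>0 \<Delta>\<^bsup>(n+1)/2\<^esup>\<close> makes the choice of
  a nonzero \<open>r\<^sub>0\<close> the choice of a nonzero \<open>\<omega>\<close>; using \<open>\<omega>\<close> avoids fractional powers of \<open>\<Delta>\<close>.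
\<close>

type_synonym 'a transformation = "'a \<times> 'a \<times> 'a \<times> 'a \<times> 'a"

definition G :: "'a::field_char_0 transformation set"
  where "G = {(k1, k2, k3, k4, \<omega>). (k4 = 0 \<or> k4 = 1) \<and> k2 * k3 - k1 * k4 \<noteq> 0 \<and> \<omega> \<noteq> 0}"

fun act :: "nat \<Rightarrow> 'a::field_char_0 transformation \<Rightarrow> ('a \<Rightarrow> 'a) \<Rightarrow> 'a \<Rightarrow> 'a"
  where "act n (k1, k2, k3, k4, \<omega>) \<alpha> =
    (\<lambda>x. \<alpha> ((k2 * x + k1) / (k4 * x + k3)) * (\<omega> / (k4 * x + k3) ^ (n + 1)))"

definition G_equiv :: "nat \<Rightarrow> (('a \<Rightarrow> 'a \<Rightarrow> 'a) \<times> ('a \<Rightarrow> 'a \<Rightarrow> 'a::field_char_0)) set"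
  where "G_equiv n = {(lin \<alpha>, lin \<beta>) | \<alpha> \<beta>. \<exists>g \<in> G. \<beta> \<simeq> act n g \<alpha>}"

definition nonequivalent ::
    "nat \<Rightarrow> ('a \<Rightarrow> 'a \<Rightarrow> 'a) set \<Rightarrow> ('a \<Rightarrow> 'a \<Rightarrow> 'a::field_char_0) set \<Rightarrow> bool"
  where "nonequivalent n A B \<longleftrightarrow> (\<forall>F \<in> A. \<forall>H \<in> B. (F, H) \<notin> G_equiv n)"

definition E1 :: "nat \<Rightarrow> ('a \<Rightarrow> 'a \<Rightarrow> 'a::field_char_0) set"
  where "E1 n = {lin \<beta> | \<beta>. \<exists>\<gamma> k3 k4. \<gamma> \<noteq> 0 \<and> (k3, k4) \<noteq> (0, 0) \<and>
    \<beta> \<simeq> (\<lambda>x. \<gamma> / (k4 * x + k3) ^ (n + 1))}"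

text \<open>
  In \<open>E2\<close> and \<open>E3\<close> the coefficient \<open>p\<close> may vanish: for instance \<open>x \<mapsto> 1/x\<close> carries \<open>x y\<close> to
  \<open>y / x\<^bsup>n+2\<^esup>\<close> and \<open>y / x\<close> to \<open>y / x\<^bsup>n\<^esup>\<close>, so the sets restricted to \<open>p \<noteq> 0\<close> are not closed
  under the action.
\<close>

definition E2 :: "nat \<Rightarrow> ('a \<Rightarrow> 'a \<Rightarrow> 'a::field_char_0) set"
  where "E2 n = {lin \<beta> | \<beta>. \<exists>\<gamma> p q k3 k4. \<gamma> \<noteq> 0 \<and> (k3, k4) \<noteq> (0, 0) \<and> p * k3 - k4 * q \<noteq> 0 \<and>
    \<beta> \<simeq> (\<lambda>x. \<gamma> * (p * x + q) / (k4 * x + k3) ^ (n + 2))}"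

definition E3 :: "nat \<Rightarrow> ('a \<Rightarrow> 'a \<Rightarrow> 'a::field_char_0) set"
  where "E3 n = {lin \<beta> | \<beta>. \<exists>\<gamma> p q k3 k4. \<gamma> \<noteq> 0 \<and> (k3, k4) \<noteq> (0, 0) \<and> p * k3 - k4 * q \<noteq> 0 \<and>
    \<beta> \<simeq> (\<lambda>x. \<gamma> / ((p * x + q) * (k4 * x + k3) ^ n))}"

text \<open>
  For \<open>p = l = 1\<close> the coefficient is \<open>\<gamma>(x + q) / ((x + \<sigma>)(k\<^sub>4 x + k\<^sub>3)\<^bsup>n+1\<^esup>)\<close> with \<open>q \<noteq> \<sigma>\<close>,
  \<open>k\<^sub>4 \<sigma> - k\<^sub>3 \<noteq> 0\<close> and \<open>k\<^sub>4 q - k\<^sub>3 \<noteq> 0\<close>.  The last condition keeps \<open>x + q\<close> from cancelling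
  against \<open>k\<^sub>4 x + k\<^sub>3\<close>, which would give an element of \<open>E3\<close>.  The cases \<open>p = 0\<close> and \<open>l = 0\<close> are
  needed for closure under the action, as in \<open>E2\<close> and \<open>E3\<close>.
\<close>

definition E4 :: "nat \<Rightarrow> ('a \<Rightarrow> 'a \<Rightarrow> 'a::field_char_0) set"
  where "E4 n = {lin \<beta> | \<beta>. \<exists>\<gamma> p q l \<sigma> k3 k4. \<gamma> \<noteq> 0 \<and> (k3, k4) \<noteq> (0, 0) \<and>
    p * \<sigma> - l * q \<noteq> 0 \<and> k4 * \<sigma> - l * k3 \<noteq> 0 \<and> k4 * q - p * k3 \<noteq> 0 \<and>
    \<beta> \<simeq> (\<lambda>x. \<gamma> * (p * x + q) / ((l * x + \<sigma>) * (k4 * x + k3) ^ (n + 1)))}"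

end

theory Submission
  imports Defs "HOL-Computational_Algebra.Polynomial"
begin

text \<open>
  The normalisation \<open>k\<^sub>4 \<in> {0, 1}\<close> is immaterial: rescaling a matrix does not change its
  fractional linear map and only multiplies the factor \<open>\<omega> / (k\<^sub>4 x + k\<^sub>3)\<^bsup>n+1\<^esup>\<close> by a nonzero
  constant (\<open>G_equiv_iff\<close>).  So all invertible matrices may be used, and since these
  compose and invert, equivalence is symmetric and transitive (\<open>G_equiv_sym\<close>, \<open>G_equiv_trans\<close>).

  A coefficient behaves under the action like a form of degree \<open>-(n+1)\<close> on the projective line,
  into which a matrix is substituted.  The four model functions are, in this sense, products of
  powers of one, two, two and three pairwise independent linear forms:
  \<open>L\<^bsup>-(n+1)\<^esup>\<close>, \<open>L M\<^bsup>-(n+2)\<^esup>\<close>, \<open>L\<^bsup>-1\<^esup> M\<^bsup>-n\<^esup>\<close> and \<open>L M\<^bsup>-1\<^esup> N\<^bsup>-(n+1)\<^esup>\<close>.  Substituting a matrix keeps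
  this shape, which gives one inclusion for each orbit.  For the other, it has to be shown that the
  forms in a given product can be reached, and this is possible because an invertible matrix can
  send two independent forms to any two independent forms, and three pairwise independent forms to
  any others up to scaling.

  Orbits of a symmetric and transitive relation with one nonequivalent pair of representatives are
  nonequivalent throughout, so for the last claim it is enough to compare one convenient
  representative of one class with the other class.  The functions \<open>x\<close> and \<open>x / (x + 1)\<close>, from
  the second and fourth class, have a zero at \<open>0\<close>, whereas no function of the first or third
  class has a finite zero.  The functions \<open>1\<close> and \<open>x\<close>, from the first and second class,
  have no finite poles, whereas each function of the third or fourth class has one: two independent
  linear forms in its denominator cannot both be constant, and in the fourth class the numerator is
  independent of both, so that nothing cancels.
\<close>

section \<open>Coefficients up to finitely many points\<close>

lemma same_fun_sym: "\<alpha> \<simeq> \<beta> \<Longrightarrow> \<beta> \<simeq> \<alpha>"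
  unfolding same_fun_def by (simp add: eq_commute)

lemma same_fun_trans:
  assumes "\<alpha> \<simeq> \<beta>" "\<beta> \<simeq> \<delta>"
  shows "\<alpha> \<simeq> \<delta>"
  using assms unfolding same_fun_def by eventually_elim simp

lemma eventually_linear_nonzero:
  fixes c d :: "'a::field_char_0"
  assumes "c \<noteq> 0 \<or> d \<noteq> 0"
  shows "\<forall>\<^sub>F x in cofinite. c * x + d \<noteq> 0"
proof -
  have "{x. c * x + d = 0} \<subseteq> {- d / c}"
    using assms by (cases "c = 0") (auto simp: field_simps eq_neg_iff_add_eq_0)
  then show ?thesis
    by (auto simp: eventually_cofinite intro: finite_subset)
qed

lemma eventually_poly_nonzero:
  fixes P :: "'a::field_char_0 poly"
  assumes "P \<noteq> 0"
  shows "\<forall>\<^sub>F x in cofinite. poly P x \<noteq> 0"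
  using poly_roots_finite[OF assms] by (simp add: eventually_cofinite)

lemma poly_linear: "poly [:b, a:] x = a * x + (b :: 'a::comm_semiring_0)"
  by (simp add: ac_simps)

lemma poly_const: "poly [:b:] x = (b :: 'a::comm_semiring_0)"
  by simp

text \<open>
  Equality of two rational functions off a finite set becomes, after clearing denominators, an
  equality of polynomials, which may then also be evaluated at the zeros and poles.
\<close>

lemma same_fun_cross_multiply:
  fixes A B C D :: "'a::field_char_0 poly"
  assumes "(\<lambda>x. poly A x / poly B x) \<simeq> (\<lambda>x. poly C x / poly D x)" "B \<noteq> 0" "D \<noteq> 0"
  shows "A * D = C * B"
proof (rule ccontr)
  assume "A * D \<noteq> C * B"
  then have "\<forall>\<^sub>F x in cofinite. poly (A * D - C * B) x \<noteq> 0"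
    by (intro eventually_poly_nonzero) simp
  moreover have "\<forall>\<^sub>F x in cofinite. poly (A * D - C * B) x = 0"
    using assms(1)[unfolded same_fun_def] eventually_poly_nonzero[OF assms(2)]
      eventually_poly_nonzero[OF assms(3)]
    by eventually_elim (simp add: field_simps)
  ultimately have "\<forall>\<^sub>F x::'a in cofinite. False"
    by eventually_elim simp
  then show False
    by (simp add: eventually_cofinite infinite_UNIV_char_0)
qed

section \<open>Equivalence under arbitrary invertible matrices\<close>

lemma act_same_fun:
  fixes \<alpha> \<beta> :: "'a::field_char_0 \<Rightarrow> 'a"
  assumes "\<alpha> \<simeq> \<beta>" and det: "a * d - b * c \<noteq> 0"
  shows "act n (b, a, d, c, \<omega>) \<alpha> \<simeq> act n (b, a, d, c, \<omega>) \<beta>"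
proof -
  let ?m = "\<lambda>x. (a * x + b) / (c * x + d)"
  let ?S = "{x. c * x + d \<noteq> 0}"
  have "inj_on ?m ?S"
  proof (rule inj_onI)
    fix x y assume "x \<in> ?S" "y \<in> ?S" "?m x = ?m y"
    then have "(a * x + b) * (c * y + d) = (a * y + b) * (c * x + d)"
      by (simp add: field_simps)
    then have "(a * d - b * c) * (x - y) = 0"
      by (simp add: algebra_simps)
    with det show "x = y" by simp
  qed
  then have "finite (?m -` {y. \<alpha> y \<noteq> \<beta> y} \<inter> ?S)"
    using assms(1) by (intro finite_vimage_IntI) (simp_all add: same_fun_def eventually_cofinite)
  then have "\<forall>\<^sub>F x in cofinite. \<not> (\<alpha> (?m x) \<noteq> \<beta> (?m x) \<and> c * x + d \<noteq> 0)"
    by (simp add: eventually_cofinite vimage_def Int_def)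
  moreover have "\<forall>\<^sub>F x in cofinite. c * x + d \<noteq> 0"
    using det by (intro eventually_linear_nonzero) auto
  ultimately show ?thesis
    unfolding same_fun_def by eventually_elim simp
qed

text \<open>
  The denominators form a cocycle for matrix multiplication: the one of the product is the one
  of the outer map, evaluated at the image point, times the one of the inner map.
\<close>

lemma act_act:
  fixes \<alpha> :: "'a::field_char_0 \<Rightarrow> 'a"
  assumes "a' * d' - b' * c' \<noteq> 0"
  shows "act n (b', a', d', c', \<omega>') (act n (b, a, d, c, \<omega>) \<alpha>) \<simeq>
    act n (a * b' + b * d', a * a' + b * c', c * b' + d * d', c * a' + d * c', \<omega> * \<omega>') \<alpha>"
proof -
  have "\<forall>\<^sub>F x in cofinite. c' * x + d' \<noteq> 0"
    using assms by (intro eventually_linear_nonzero) auto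
  then show ?thesis
    unfolding same_fun_def
  proof eventually_elim
    case (elim x)
    let ?y = "(a' * x + b') / (c' * x + d')"
    have num: "a * ?y + b = ((a * a' + b * c') * x + (a * b' + b * d')) / (c' * x + d')"
      and den: "c * ?y + d = ((c * a' + d * c') * x + (c * b' + d * d')) / (c' * x + d')"
      using elim by (simp_all add: field_simps)
    show ?case
      unfolding act.simps num den using elim by (simp add: power_divide)
  qed
qed

text \<open>
  The rows of the matrix are \<open>(a, b)\<close> and \<open>(c, d)\<close>, so that \<open>(k\<^sub>1, k\<^sub>2, k\<^sub>3, k\<^sub>4) = (b, a, d, c)\<close>.
\<close>

definition matrix_equiv :: "nat \<Rightarrow> ('a \<Rightarrow> 'a) \<Rightarrow> ('a \<Rightarrow> 'a::field_char_0) \<Rightarrow> bool"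
  where "matrix_equiv n \<alpha> \<beta> \<longleftrightarrow>
    (\<exists>a b c d \<omega>. a * d - b * c \<noteq> 0 \<and> \<omega> \<noteq> 0 \<and> \<beta> \<simeq> act n (b, a, d, c, \<omega>) \<alpha>)"

lemma matrix_equivI:
  assumes "a * d - b * c \<noteq> 0" "\<omega> \<noteq> 0" "\<beta> \<simeq> act n (b, a, d, c, \<omega>) \<alpha>"
  shows "matrix_equiv n \<alpha> \<beta>"
  using assms unfolding matrix_equiv_def by blast

lemma matrix_equivE:
  assumes "matrix_equiv n \<alpha> \<beta>"
  obtains a b c d \<omega>
  where "a * d - b * c \<noteq> 0" "\<omega> \<noteq> 0" "\<beta> \<simeq> act n (b, a, d, c, \<omega>) \<alpha>"
  using assms unfolding matrix_equiv_def by blast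

lemma matrix_equiv_trans:
  assumes "matrix_equiv n \<alpha> \<beta>" "matrix_equiv n \<beta> \<delta>"
  shows "matrix_equiv n \<alpha> \<delta>"
proof -
  obtain a b c d \<omega> where 1: "a * d - b * c \<noteq> 0" "\<omega> \<noteq> 0" "\<beta> \<simeq> act n (b, a, d, c, \<omega>) \<alpha>"
    using assms(1) by (rule matrix_equivE)
  obtain a' b' c' d' \<omega>' where 2: "a' * d' - b' * c' \<noteq> 0" "\<omega>' \<noteq> 0"
      "\<delta> \<simeq> act n (b', a', d', c', \<omega>') \<beta>"
    using assms(2) by (rule matrix_equivE)
  have "(a * a' + b * c') * (c * b' + d * d') - (a * b' + b * d') * (c * a' + d * c')
      = (a * d - b * c) * (a' * d' - b' * c')"
    by (simp add: algebra_simps)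
  moreover have "\<delta> \<simeq>
      act n (a * b' + b * d', a * a' + b * c', c * b' + d * d', c * a' + d * c', \<omega> * \<omega>') \<alpha>"
    using 2(3) act_same_fun[OF 1(3) 2(1)] act_act[OF 2(1)] by (blast intro: same_fun_trans)
  ultimately show ?thesis
    using 1 2 by (intro matrix_equivI) simp_all
qed

lemma matrix_equiv_sym:
  assumes "matrix_equiv n \<alpha> \<beta>"
  shows "matrix_equiv n \<beta> \<alpha>"
proof -
  obtain a b c d \<omega> where 1: "a * d - b * c \<noteq> 0" "\<omega> \<noteq> 0" "\<beta> \<simeq> act n (b, a, d, c, \<omega>) \<alpha>"
    using assms by (rule matrix_equivE)
  let ?\<Delta> = "a * d - b * c"
  \<comment> \<open>The adjugate matrix inverts up to the scalar \<open>\<Delta>\<close>, which the last component compensates.\<close>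
  let ?inv = "(- b, d, a, - c, ?\<Delta> ^ (n + 1) / \<omega>)"
  have det: "d * a - (- b) * (- c) \<noteq> 0"
    using 1(1) by (simp add: mult.commute)
  have "act n ?inv (act n (b, a, d, c, \<omega>) \<alpha>) \<simeq>
      act n (a * - b + b * a, a * d + b * - c, c * - b + d * a, c * d + d * - c,
        \<omega> * (?\<Delta> ^ (n + 1) / \<omega>)) \<alpha>"
    by (rule act_act[OF det])
  also have "\<dots> = \<alpha>"
  proof -
    have entries: "a * - b + b * a = 0" "a * d + b * - c = ?\<Delta>"
        "c * - b + d * a = ?\<Delta>" "c * d + d * - c = 0"
      by (simp_all add: mult.commute)
    show ?thesis
      unfolding entries act.simps using 1(1,2) by simp
  qed
  finally have "act n ?inv \<beta> \<simeq> \<alpha>"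
    using act_same_fun[OF 1(3) det] same_fun_trans by blast
  then show ?thesis
    using 1 det by (intro matrix_equivI[where \<omega> = "?\<Delta> ^ (n + 1) / \<omega>", OF det])
      (auto intro: same_fun_sym)
qed

lemma lin_eq_iff: "lin \<alpha> = lin \<beta> \<longleftrightarrow> \<alpha> = \<beta>"
proof
  assume "lin \<alpha> = lin \<beta>"
  then have "lin \<alpha> x 1 = lin \<beta> x 1" for x by simp
  then show "\<alpha> = \<beta>" by (auto simp: lin_def)
qed simp

lemma lin_mem_iff: "lin \<alpha> \<in> {lin \<beta> | \<beta>. P \<beta>} \<longleftrightarrow> P \<alpha>"
  by (auto simp: lin_eq_iff)

text \<open>Dividing an invertible matrix by its entry \<open>c\<close>, if that is nonzero, puts it into \<open>G\<close>.\<close>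

lemma matrix_equiv_normalise:
  assumes "matrix_equiv n \<alpha> \<beta>"
  shows "\<exists>g \<in> G. \<beta> \<simeq> act n g \<alpha>"
proof -
  obtain a b c d \<omega> where 1: "a * d - b * c \<noteq> 0" "\<omega> \<noteq> 0" "\<beta> \<simeq> act n (b, a, d, c, \<omega>) \<alpha>"
    using assms by (rule matrix_equivE)
  define t where "t = (if c = 0 then 1 else c)"
  have t: "t \<noteq> 0" and c: "c / t = 0 \<or> c / t = 1"
    by (auto simp: t_def)
  have scale: "k / t * x + l / t = (k * x + l) / t" for k l x
    by (simp add: add_divide_distrib)
  have "act n (b / t, a / t, d / t, c / t, \<omega> / t ^ (n + 1)) \<alpha> = act n (b, a, d, c, \<omega>) \<alpha>"
    unfolding act.simps scale using t by (simp add: power_divide)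
  moreover have "a / t * (d / t) - b / t * (c / t) \<noteq> 0"
    using 1(1) t by (simp add: field_simps)
  ultimately show ?thesis
    using 1 t c by (intro bexI[of _ "(b / t, a / t, d / t, c / t, \<omega> / t ^ (n + 1))"])
      (simp_all add: G_def)
qed

lemma G_equiv_iff: "(lin \<alpha>, lin \<beta>) \<in> G_equiv n \<longleftrightarrow> matrix_equiv n \<alpha> \<beta>"
proof
  assume "(lin \<alpha>, lin \<beta>) \<in> G_equiv n"
  then obtain g where "g \<in> G" "\<beta> \<simeq> act n g \<alpha>"
    by (auto simp: G_equiv_def lin_eq_iff)
  then show "matrix_equiv n \<alpha> \<beta>"
    by (cases g) (force simp: G_def mult.commute simp del: act.simps intro!: matrix_equivI)
next
  assume "matrix_equiv n \<alpha> \<beta>"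
  from matrix_equiv_normalise[OF this] show "(lin \<alpha>, lin \<beta>) \<in> G_equiv n"
    by (auto simp: G_equiv_def)
qed

lemma G_equiv_linE:
  assumes "(F, H) \<in> G_equiv n"
  obtains \<alpha> \<beta> where "F = lin \<alpha>" "H = lin \<beta>" "matrix_equiv n \<alpha> \<beta>"
  using assms G_equiv_iff[where n = n] unfolding G_equiv_def by blast

lemma G_equiv_sym: "(F, H) \<in> G_equiv n \<Longrightarrow> (H, F) \<in> G_equiv n"
  by (auto elim!: G_equiv_linE simp: G_equiv_iff intro: matrix_equiv_sym)

lemma G_equiv_trans: "(F, H) \<in> G_equiv n \<Longrightarrow> (H, K) \<in> G_equiv n \<Longrightarrow> (F, K) \<in> G_equiv n"
  by (auto elim!: G_equiv_linE simp: G_equiv_iff lin_eq_iff intro: matrix_equiv_trans)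

lemma G_equiv_orbit: "G_equiv n `` {lin \<alpha>} = {lin \<beta> | \<beta>. matrix_equiv n \<alpha> \<beta>}"
  by (auto elim!: G_equiv_linE simp: G_equiv_iff lin_eq_iff)

section \<open>The four orbits\<close>

lemma orbit_const:
  fixes \<theta> :: "'a::field_char_0"
  assumes "\<theta> \<noteq> 0"
  shows "G_equiv n `` {lin (\<lambda>x. \<theta>)} = E1 n"
proof -
  have "matrix_equiv n (\<lambda>x. \<theta>) \<beta> \<longleftrightarrow>
      (\<exists>\<gamma> k3 k4. \<gamma> \<noteq> 0 \<and> (k3, k4) \<noteq> (0, 0) \<and> \<beta> \<simeq> (\<lambda>x. \<gamma> / (k4 * x + k3) ^ (n + 1)))"
    (is "_ = ?R") for \<beta> :: "'a \<Rightarrow> 'a"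
  proof
    assume "matrix_equiv n (\<lambda>x. \<theta>) \<beta>"
    then obtain a b c d \<omega> where "a * d - b * c \<noteq> 0" "\<omega> \<noteq> 0"
        "\<beta> \<simeq> act n (b, a, d, c, \<omega>) (\<lambda>x. \<theta>)"
      by (rule matrix_equivE)
    then show ?R
      using assms by (intro exI[of _ "\<theta> * \<omega>"] exI[of _ d] exI[of _ c]) auto
  next
    assume ?R
    then obtain \<gamma> k3 k4 where *: "\<gamma> \<noteq> 0" "(k3, k4) \<noteq> (0, 0)"
        "\<beta> \<simeq> (\<lambda>x. \<gamma> / (k4 * x + k3) ^ (n + 1))"
      by blast
    \<comment> \<open>Any first row independent of \<open>(k\<^sub>4, k\<^sub>3)\<close> completes the matrix.\<close>
    obtain a b where "a * k3 - b * k4 \<noteq> 0"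
    proof (cases "k3 = 0")
      case True
      then show ?thesis using that[of 0 1] *(2) by simp
    next
      case False
      then show ?thesis using that[of 1 0] by simp
    qed
    then show "matrix_equiv n (\<lambda>x. \<theta>) \<beta>"
      using * assms by (intro matrix_equivI[where \<omega> = "\<gamma> / \<theta>" and a = a and b = b]) auto
  qed
  then show ?thesis
    unfolding G_equiv_orbit E1_def by simp
qed

text \<open>
  Substituting a matrix multiplies the coefficient row \<open>(u, v)\<close> by the matrix, and clearing the
  inner denominator changes the power of \<open>c x + d\<close> by one; this is \<open>subst\<close>.  Conversely, when the
  second row of the matrix is prescribed as \<open>(k\<^sub>4, k\<^sub>3)\<close>, the first row can be adjusted so that
  the product is any given \<open>(p, q)\<close>, because \<open>u \<noteq> 0\<close>.  The same argument applies to \<open>1 / (u x + v)\<close>.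
\<close>

lemma orbit_linear:
  fixes u v :: "'a::field_char_0"
  assumes "u \<noteq> 0"
  shows "G_equiv n `` {lin (\<lambda>x. u * x + v)} = E2 n"
proof -
  have subst: "act n (b, a, d, c, \<omega>) (\<lambda>x. u * x + v) \<simeq>
      (\<lambda>x. \<omega> * ((u * a + v * c) * x + (u * b + v * d)) / (c * x + d) ^ (n + 2))"
    if "a * d - b * c \<noteq> 0" for a b c d \<omega>
  proof -
    have "\<forall>\<^sub>F x in cofinite. c * x + d \<noteq> 0"
      using that by (intro eventually_linear_nonzero) auto
    then show ?thesis
      unfolding same_fun_def by eventually_elim (simp add: field_simps)
  qed
  have "matrix_equiv n (\<lambda>x. u * x + v) \<beta> \<longleftrightarrow>
      (\<exists>\<gamma> p q k3 k4. \<gamma> \<noteq> 0 \<and> (k3, k4) \<noteq> (0, 0) \<and> p * k3 - k4 * q \<noteq> 0 \<and>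
        \<beta> \<simeq> (\<lambda>x. \<gamma> * (p * x + q) / (k4 * x + k3) ^ (n + 2)))"
    (is "_ = ?R") for \<beta> :: "'a \<Rightarrow> 'a"
  proof
    assume "matrix_equiv n (\<lambda>x. u * x + v) \<beta>"
    then obtain a b c d \<omega> where *: "a * d - b * c \<noteq> 0" "\<omega> \<noteq> 0"
        "\<beta> \<simeq> act n (b, a, d, c, \<omega>) (\<lambda>x. u * x + v)"
      by (rule matrix_equivE)
    have "(u * a + v * c) * d - c * (u * b + v * d) = u * (a * d - b * c)"
      by (simp add: algebra_simps)
    moreover have "(d, c) \<noteq> (0, 0)"
      using *(1) by auto
    ultimately have "(u * a + v * c) * d - c * (u * b + v * d) \<noteq> 0 \<and> (d, c) \<noteq> (0, 0)"
      using * assms by simp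
    then show ?R
      using *(2) same_fun_trans[OF *(3) subst[OF *(1)]] by blast
  next
    assume ?R
    then obtain \<gamma> p q k3 k4 where *: "\<gamma> \<noteq> 0" "p * k3 - k4 * q \<noteq> 0"
        "\<beta> \<simeq> (\<lambda>x. \<gamma> * (p * x + q) / (k4 * x + k3) ^ (n + 2))"
      by blast
    define a b where "a = (p - v * k4) / u" and "b = (q - v * k3) / u"
    have p: "u * a + v * k4 = p" and q: "u * b + v * k3 = q"
      using assms by (simp_all add: a_def b_def)
    have "p * k3 - k4 * q = u * (a * k3 - b * k4)"
      unfolding p[symmetric] q[symmetric] by (simp add: algebra_simps)
    then have det: "a * k3 - b * k4 \<noteq> 0"
      using *(2) by auto
    show "matrix_equiv n (\<lambda>x. u * x + v) \<beta>"
      using same_fun_trans[OF *(3) same_fun_sym[OF subst[OF det, unfolded p q]]]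
      by (rule matrix_equivI[OF det *(1)])
  qed
  then show ?thesis
    unfolding G_equiv_orbit E2_def by simp
qed

lemma orbit_inverse_linear:
  fixes u v :: "'a::field_char_0"
  assumes "u \<noteq> 0"
  shows "G_equiv n `` {lin (\<lambda>x. 1 / (u * x + v))} = E3 n"
proof -
  have subst: "act n (b, a, d, c, \<omega>) (\<lambda>x. 1 / (u * x + v)) \<simeq>
      (\<lambda>x. \<omega> / (((u * a + v * c) * x + (u * b + v * d)) * (c * x + d) ^ n))"
    if "a * d - b * c \<noteq> 0" for a b c d \<omega>
  proof -
    have "\<forall>\<^sub>F x in cofinite. c * x + d \<noteq> 0"
      using that by (intro eventually_linear_nonzero) auto
    then show ?thesis
      unfolding same_fun_def
    proof eventually_elim
      case (elim x)
      have "u * ((a * x + b) / (c * x + d)) + v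
          = ((u * a + v * c) * x + (u * b + v * d)) / (c * x + d)"
        using elim by (simp add: field_simps)
      then show ?case
        using elim by simp
    qed
  qed
  have "matrix_equiv n (\<lambda>x. 1 / (u * x + v)) \<beta> \<longleftrightarrow>
      (\<exists>\<gamma> p q k3 k4. \<gamma> \<noteq> 0 \<and> (k3, k4) \<noteq> (0, 0) \<and> p * k3 - k4 * q \<noteq> 0 \<and>
        \<beta> \<simeq> (\<lambda>x. \<gamma> / ((p * x + q) * (k4 * x + k3) ^ n)))"
    (is "_ = ?R") for \<beta> :: "'a \<Rightarrow> 'a"
  proof
    assume "matrix_equiv n (\<lambda>x. 1 / (u * x + v)) \<beta>"
    then obtain a b c d \<omega> where *: "a * d - b * c \<noteq> 0" "\<omega> \<noteq> 0"
        "\<beta> \<simeq> act n (b, a, d, c, \<omega>) (\<lambda>x. 1 / (u * x + v))"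
      by (rule matrix_equivE)
    have "(u * a + v * c) * d - c * (u * b + v * d) = u * (a * d - b * c)"
      by (simp add: algebra_simps)
    moreover have "(d, c) \<noteq> (0, 0)"
      using *(1) by auto
    ultimately have "(u * a + v * c) * d - c * (u * b + v * d) \<noteq> 0 \<and> (d, c) \<noteq> (0, 0)"
      using * assms by simp
    then show ?R
      using *(2) same_fun_trans[OF *(3) subst[OF *(1)]] by blast
  next
    assume ?R
    then obtain \<gamma> p q k3 k4 where *: "\<gamma> \<noteq> 0" "p * k3 - k4 * q \<noteq> 0"
        "\<beta> \<simeq> (\<lambda>x. \<gamma> / ((p * x + q) * (k4 * x + k3) ^ n))"
      by blast
    define a b where "a = (p - v * k4) / u" and "b = (q - v * k3) / u"
    have p: "u * a + v * k4 = p" and q: "u * b + v * k3 = q"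
      using assms by (simp_all add: a_def b_def)
    have "p * k3 - k4 * q = u * (a * k3 - b * k4)"
      unfolding p[symmetric] q[symmetric] by (simp add: algebra_simps)
    then have det: "a * k3 - b * k4 \<noteq> 0"
      using *(2) by auto
    show "matrix_equiv n (\<lambda>x. 1 / (u * x + v)) \<beta>"
      using same_fun_trans[OF *(3) same_fun_sym[OF subst[OF det, unfolded p q]]]
      by (rule matrix_equivI[OF det *(1)])
  qed
  then show ?thesis
    unfolding G_equiv_orbit E3_def by simp
qed

text \<open>
  Here the rows \<open>(p, q)\<close> and \<open>(l, \<sigma>)\<close> of the transformed function differ by \<open>(r - s)\<close> times
  \<open>(k\<^sub>4, k\<^sub>3)\<close>.  Three given pairwise independent rows satisfy such a relation after the first two
  are multiplied by suitable nonzero scalars, which \<open>\<omega>\<close> absorbs.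
\<close>

lemma orbit_linear_fractional:
  fixes r s :: "'a::field_char_0"
  assumes "r \<noteq> s"
  shows "G_equiv n `` {lin (\<lambda>x. (x + r) / (x + s))} = E4 n"
proof -
  have subst: "act n (b, a, d, c, \<omega>) (\<lambda>x. (x + r) / (x + s)) \<simeq>
      (\<lambda>x. \<omega> * ((a + r * c) * x + (b + r * d))
        / (((a + s * c) * x + (b + s * d)) * (c * x + d) ^ (n + 1)))"
    if "a * d - b * c \<noteq> 0" for a b c d \<omega>
  proof -
    have "\<forall>\<^sub>F x in cofinite. c * x + d \<noteq> 0"
      using that by (intro eventually_linear_nonzero) auto
    then show ?thesis
      unfolding same_fun_def
    proof eventually_elim
      case (elim x)
      have "(a * x + b) / (c * x + d) + t = ((a + t * c) * x + (b + t * d)) / (c * x + d)" for t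
        using elim by (simp add: field_simps)
      then show ?case
        using elim by (simp add: mult.commute)
    qed
  qed
  have "matrix_equiv n (\<lambda>x. (x + r) / (x + s)) \<beta> \<longleftrightarrow>
      (\<exists>\<gamma> p q l \<sigma> k3 k4. \<gamma> \<noteq> 0 \<and> (k3, k4) \<noteq> (0, 0) \<and>
        p * \<sigma> - l * q \<noteq> 0 \<and> k4 * \<sigma> - l * k3 \<noteq> 0 \<and> k4 * q - p * k3 \<noteq> 0 \<and>
        \<beta> \<simeq> (\<lambda>x. \<gamma> * (p * x + q) / ((l * x + \<sigma>) * (k4 * x + k3) ^ (n + 1))))"
    (is "_ = ?R") for \<beta> :: "'a \<Rightarrow> 'a"
  proof
    assume "matrix_equiv n (\<lambda>x. (x + r) / (x + s)) \<beta>"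
    then obtain a b c d \<omega> where *: "a * d - b * c \<noteq> 0" "\<omega> \<noteq> 0"
        "\<beta> \<simeq> act n (b, a, d, c, \<omega>) (\<lambda>x. (x + r) / (x + s))"
      by (rule matrix_equivE)
    have "(a + r * c) * (b + s * d) - (a + s * c) * (b + r * d) = (s - r) * (a * d - b * c)"
      by (simp add: algebra_simps)
    then have "(a + r * c) * (b + s * d) - (a + s * c) * (b + r * d) \<noteq> 0"
      using *(1) assms by simp
    moreover have "c * (b + t * d) - (a + t * c) * d \<noteq> 0" for t
    proof -
      have "c * (b + t * d) - (a + t * c) * d = - (a * d - b * c)"
        by (simp add: algebra_simps)
      then show ?thesis using *(1) by simp
    qed
    moreover have "(d, c) \<noteq> (0, 0)"
      using *(1) by auto
    ultimately show ?R
      using *(2) same_fun_trans[OF *(3) subst[OF *(1)]] by blast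
  next
    assume ?R
    then obtain \<gamma> p q l \<sigma> k3 k4 where *: "\<gamma> \<noteq> 0" "p * \<sigma> - l * q \<noteq> 0"
        "k4 * \<sigma> - l * k3 \<noteq> 0" "k4 * q - p * k3 \<noteq> 0"
        "\<beta> \<simeq> (\<lambda>x. \<gamma> * (p * x + q) / ((l * x + \<sigma>) * (k4 * x + k3) ^ (n + 1)))"
      by blast
    let ?D = "p * \<sigma> - l * q"
    \<comment> \<open>Cramer's rule for \<open>e (p, q) - f (l, \<sigma>) = (r - s) (k\<^sub>4, k\<^sub>3)\<close>.\<close>
    define e f where "e = (r - s) * (k4 * \<sigma> - l * k3) / ?D"
      and "f = (r - s) * (k4 * q - p * k3) / ?D"
    have nz: "e \<noteq> 0" "f \<noteq> 0"
      using * assms by (simp_all add: e_def f_def)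
    have "e * p - f * l = (r - s) * k4 * ?D / ?D" "e * q - f * \<sigma> = (r - s) * k3 * ?D / ?D"
      unfolding e_def f_def
      by (simp_all add: algebra_simps flip: add_divide_distrib diff_divide_distrib)
    then have cramer: "e * p - f * l = (r - s) * k4" "e * q - f * \<sigma> = (r - s) * k3"
      using *(2) by simp_all
    define a b where "a = e * p - r * k4" and "b = e * q - r * k3"
    have rows: "a + r * k4 = e * p" "b + r * k3 = e * q" "a + s * k4 = f * l" "b + s * k3 = f * \<sigma>"
      using cramer by (simp_all add: a_def b_def algebra_simps)
    have "a * k3 - b * k4 = - e * (k4 * q - p * k3)"
      by (simp add: a_def b_def algebra_simps)
    then have det: "a * k3 - b * k4 \<noteq> 0"
      using *(4) nz by simp
    have "act n (b, a, k3, k4, \<gamma> * f / e) (\<lambda>x. (x + r) / (x + s)) \<simeq>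
        (\<lambda>x. \<gamma> * f / e * (e * p * x + e * q) / ((f * l * x + f * \<sigma>) * (k4 * x + k3) ^ (n + 1)))"
      using subst[OF det, of "\<gamma> * f / e"] unfolding rows .
    also have "\<dots> = (\<lambda>x. \<gamma> * (p * x + q) / ((l * x + \<sigma>) * (k4 * x + k3) ^ (n + 1)))"
    proof
      fix x
      have "e * p * x + e * q = e * (p * x + q)" "f * l * x + f * \<sigma> = f * (l * x + \<sigma>)"
        by (simp_all add: algebra_simps)
      then show "\<gamma> * f / e * (e * p * x + e * q) / ((f * l * x + f * \<sigma>) * (k4 * x + k3) ^ (n + 1))
          = \<gamma> * (p * x + q) / ((l * x + \<sigma>) * (k4 * x + k3) ^ (n + 1))"
        using nz by simp
    qed
    finally show "matrix_equiv n (\<lambda>x. (x + r) / (x + s)) \<beta>"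
      using * nz by (intro matrix_equivI[OF det, of "\<gamma> * f / e"])
        (auto intro: same_fun_trans same_fun_sym simp del: act.simps)
  qed
  then show ?thesis
    unfolding G_equiv_orbit E4_def by simp
qed

section \<open>Separating the orbits by zeros and poles\<close>

lemma rational_with_zero_notin_E1:
  fixes A B :: "'a::field_char_0 poly"
  assumes "poly A x0 = 0" "poly B x0 \<noteq> 0"
  shows "lin (\<lambda>x. poly A x / poly B x) \<notin> E1 n"
proof
  assume "lin (\<lambda>x. poly A x / poly B x) \<in> E1 n"
  then obtain \<gamma> k3 k4 where *: "\<gamma> \<noteq> 0" "(k3, k4) \<noteq> (0, 0)"
      "(\<lambda>x. poly A x / poly B x) \<simeq> (\<lambda>x. \<gamma> / (k4 * x + k3) ^ (n + 1))"
    unfolding E1_def lin_mem_iff by blast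
  have "B \<noteq> 0" "[:k3, k4:] ^ (n + 1) \<noteq> 0"
    using *(2) assms(2) by (auto simp del: power_Suc)
  then have "A * [:k3, k4:] ^ (n + 1) = [:\<gamma>:] * B"
    using *(3) by (intro same_fun_cross_multiply)
      (simp_all only: poly_power poly_linear poly_const not_False_eq_True)
  then have "poly (A * [:k3, k4:] ^ (n + 1)) x0 = poly ([:\<gamma>:] * B) x0"
    by simp
  with assms *(1) show False by simp
qed

lemma rational_with_zero_notin_E3:
  fixes A B :: "'a::field_char_0 poly"
  assumes "poly A x0 = 0" "poly B x0 \<noteq> 0"
  shows "lin (\<lambda>x. poly A x / poly B x) \<notin> E3 n"
proof
  assume "lin (\<lambda>x. poly A x / poly B x) \<in> E3 n"
  then obtain \<gamma> p q k3 k4 where *: "\<gamma> \<noteq> 0" "p * k3 - k4 * q \<noteq> 0"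
      "(\<lambda>x. poly A x / poly B x) \<simeq> (\<lambda>x. \<gamma> / ((p * x + q) * (k4 * x + k3) ^ n))"
    unfolding E3_def lin_mem_iff by blast
  have "B \<noteq> 0" "[:q, p:] * [:k3, k4:] ^ n \<noteq> 0"
    using *(2) assms(2) by (auto simp del: mult_pCons_left)
  then have "A * ([:q, p:] * [:k3, k4:] ^ n) = [:\<gamma>:] * B"
    using *(3) by (intro same_fun_cross_multiply)
      (simp_all only: poly_mult poly_power poly_linear poly_const not_False_eq_True)
  then have "poly (A * ([:q, p:] * [:k3, k4:] ^ n)) x0 = poly ([:\<gamma>:] * B) x0"
    by simp
  with assms *(1) show False by simp
qed

text \<open>
  A linear form without a finite root has its root at infinity, and two independent forms cannot
  share that root.
\<close>

lemma independent_linear_forms_root: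
  fixes p q k l :: "'a::field"
  assumes "p * l - k * q \<noteq> 0"
  obtains x where "(p * x + q) * (k * x + l) = 0"
proof (cases "p = 0")
  case True
  then have "k \<noteq> 0" using assms by auto
  then show ?thesis using that[of "- l / k"] by simp
next
  case False
  then show ?thesis using that[of "- q / p"] by simp
qed

lemma polynomial_notin_E3:
  fixes A :: "'a::field_char_0 poly"
  assumes "n > 0"
  shows "lin (poly A) \<notin> E3 n"
proof
  assume "lin (poly A) \<in> E3 n"
  then obtain \<gamma> p q k3 k4 where *: "\<gamma> \<noteq> 0" "p * k3 - k4 * q \<noteq> 0"
      "poly A \<simeq> (\<lambda>x. \<gamma> / ((p * x + q) * (k4 * x + k3) ^ n))"
    unfolding E3_def lin_mem_iff by blast
  have "[:q, p:] * [:k3, k4:] ^ n \<noteq> 0"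
    using *(2) by (auto simp del: mult_pCons_left)
  then have eq: "A * ([:q, p:] * [:k3, k4:] ^ n) = [:\<gamma>:] * 1"
    using *(3) by (intro same_fun_cross_multiply)
      (simp_all only: poly_mult poly_power poly_linear poly_const poly_1 div_by_1
        one_neq_zero not_False_eq_True)
  obtain x where "(p * x + q) * (k4 * x + k3) = 0"
    using *(2) by (rule independent_linear_forms_root)
  then have "poly (A * ([:q, p:] * [:k3, k4:] ^ n)) x = 0"
    unfolding poly_mult poly_power poly_linear using assms by auto
  with *(1) show False unfolding eq by simp
qed

lemma polynomial_notin_E4:
  fixes A :: "'a::field_char_0 poly"
  shows "lin (poly A) \<notin> E4 n"
proof
  assume "lin (poly A) \<in> E4 n"
  then obtain \<gamma> p q l \<sigma> k3 k4 where *: "\<gamma> \<noteq> 0" "p * \<sigma> - l * q \<noteq> 0"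
      "k4 * \<sigma> - l * k3 \<noteq> 0" "k4 * q - p * k3 \<noteq> 0"
      "poly A \<simeq> (\<lambda>x. \<gamma> * (p * x + q) / ((l * x + \<sigma>) * (k4 * x + k3) ^ (n + 1)))"
    unfolding E4_def lin_mem_iff by blast
  have "[:\<sigma>, l:] * [:k3, k4:] ^ (n + 1) \<noteq> 0"
    using *(3) by (auto simp del: power_Suc mult_pCons_left)
  then have eq: "A * ([:\<sigma>, l:] * [:k3, k4:] ^ (n + 1)) = smult \<gamma> [:q, p:] * 1"
    using *(5) by (intro same_fun_cross_multiply)
      (simp_all only: poly_mult poly_power poly_smult poly_linear poly_1 div_by_1
        one_neq_zero not_False_eq_True)
  obtain x where x: "(k4 * x + k3) * (l * x + \<sigma>) = 0"
    using *(3) by (rule independent_linear_forms_root)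
  then have "poly (A * ([:\<sigma>, l:] * [:k3, k4:] ^ (n + 1))) x = 0"
    unfolding poly_mult poly_power poly_linear by auto
  then have pole: "p * x + q = 0"
    unfolding eq mult_1_right poly_smult poly_linear using *(1) by simp
  \<comment> \<open>The pole would have to cancel against \<open>p x + q\<close>, making two of the three forms proportional.\<close>
  have "p * \<sigma> - l * q = p * (l * x + \<sigma>) - l * (p * x + q)"
    "k4 * q - p * k3 = k4 * (p * x + q) - p * (k4 * x + k3)"
    by (simp_all add: algebra_simps)
  with x pole *(2,4) show False by auto
qed

lemma orbits_nonequivalent:
  assumes "G_equiv n `` {F} = A" "G_equiv n `` {H} = B" "F \<notin> B \<or> H \<notin> A"
  shows "nonequivalent n A B"
  unfolding nonequivalent_def
proof (intro ballI notI)
  fix F' H' assume "F' \<in> A" "H' \<in> B" "(F', H') \<in> G_equiv n"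
  then have "(F, H) \<in> G_equiv n"
    using assms(1,2) by (blast intro: G_equiv_sym G_equiv_trans)
  then show False
    using assms by (blast intro: G_equiv_sym)
qed

theorem proposition2:
  fixes n :: nat and \<theta> u v r s :: "'a::field_char_0"
  assumes "n \<ge> 2" and "\<theta> \<noteq> 0" and "u \<noteq> 0" and "r \<noteq> s"
  shows "G_equiv n `` {lin (\<lambda>x. \<theta>)} = E1 n
    \<and> G_equiv n `` {lin (\<lambda>x. u * x + v)} = E2 n
    \<and> G_equiv n `` {lin (\<lambda>x. 1 / (u * x + v))} = E3 n
    \<and> G_equiv n `` {lin (\<lambda>x. (x + r) / (x + s))} = E4 n
    \<and> sorted_wrt (nonequivalent n)
           [E1 n, E2 n, E3 n, E4 n :: ('a \<Rightarrow> 'a \<Rightarrow> 'a) set]"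
proof -
  define X X1 :: "'a poly" where "X = [:0, 1:]" and "X1 = [:1, 1:]"
  have E1: "G_equiv n `` {lin (poly (1 :: 'a poly))} = E1 n"
    using orbit_const[of "1::'a" n] by (simp add: poly_1[abs_def])
  have "poly X = (\<lambda>x. 1 * x + 0)"
    by (auto simp: X_def)
  then have E2: "G_equiv n `` {lin (poly X)} = E2 n"
    using orbit_linear[of "1::'a" n 0] by simp
  have E3: "G_equiv n `` {lin (\<lambda>x::'a. 1 / (1 * x + 0))} = E3 n"
    by (rule orbit_inverse_linear) simp
  have E4: "G_equiv n `` {lin (\<lambda>x. poly X x / poly X1 x)} = E4 n"
    using orbit_linear_fractional[of "0::'a" 1 n] by (simp add: X_def X1_def add.commute)
  have zero: "poly X 0 = 0" "poly X1 0 \<noteq> 0"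
    by (simp_all add: X_def X1_def)
  have x_no_zero: "lin (poly X) \<notin> E1 n" "lin (poly X) \<notin> E3 n"
    using rational_with_zero_notin_E1[of X 0 1] rational_with_zero_notin_E3[of X 0 1] zero
    by simp_all
  have one_no_pole: "lin (poly (1 :: 'a poly)) \<notin> E3 n"
    using assms(1) by (intro polynomial_notin_E3) simp
  have "nonequivalent n (E1 n) (E2 n :: ('a \<Rightarrow> 'a \<Rightarrow> 'a) set)"
    using orbits_nonequivalent[OF E1 E2] x_no_zero by blast
  moreover have "nonequivalent n (E1 n) (E3 n :: ('a \<Rightarrow> 'a \<Rightarrow> 'a) set)"
    using orbits_nonequivalent[OF E1 E3] one_no_pole by blast
  moreover have "nonequivalent n (E1 n) (E4 n :: ('a \<Rightarrow> 'a \<Rightarrow> 'a) set)"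
    using orbits_nonequivalent[OF E1 E4] polynomial_notin_E4 by blast
  moreover have "nonequivalent n (E2 n) (E3 n :: ('a \<Rightarrow> 'a \<Rightarrow> 'a) set)"
    using orbits_nonequivalent[OF E2 E3] x_no_zero by blast
  moreover have "nonequivalent n (E2 n) (E4 n :: ('a \<Rightarrow> 'a \<Rightarrow> 'a) set)"
    using orbits_nonequivalent[OF E2 E4] polynomial_notin_E4 by blast
  moreover have "nonequivalent n (E3 n) (E4 n :: ('a \<Rightarrow> 'a \<Rightarrow> 'a) set)"
    using orbits_nonequivalent[OF E3 E4] rational_with_zero_notin_E3[OF zero] by blast
  ultimately show ?thesis
    using orbit_const[OF assms(2), of n] orbit_linear[OF assms(3), of n v]
      orbit_inverse_linear[OF assms(3), of n v] orbit_linear_fractional[OF assms(4), of n] by simp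
qed

end
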